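(* Let $\Gamma$ be a distance-regular graph with diameter $d\ge 3$ and eigenvalues $\theta_0>\theta_1>\cdots>\theta_d$. Let $k, a_1, b_1$ denote its valency and intersection numbers. Then: (i) If $\Gamma$ is not bipartite, then $$\frac{k+\theta_d(a_1+1)}{(k+\theta_d)(1+\theta_d)}\ \le\ \frac{k+\theta_1(a_1+1)}{(k+\theta_1)(1+\theta_1)}.$$ (ii) (The Fundamental Bound; here $\Gamma$ may be bipartite or not) $$\left(\theta_1+\frac{k}{a_1+1}\right)\left(\theta_d+\frac{k}{a_1+1}\right)\ \ge\ -\frac{k a_1 b_1}{(a_1+1)^2}.$$
   Context: Graphs are finite, undirected, connected, without loops or multiple edges. For a graph $\Gamma=(X,R)$ with vertex set $X$, edge set $R$, path-length distance $\partial$ and diameter $d=\max\{\partial(x,y): x,y\in X\}$, put $\Gamma_i(x)=\{y\in X:\partial(x,y)=i\}$. $\Gamma$ is distance-regular if for all $0\le h,i,j\le d$ and all $x,y\in X$ with $\partial(x,y)=h$ the number $p^h_{ij}=|\Gamma_i(x)\cap\Gamma_j(y)|$ does not depend on $x,y$. Then $c_i=p^i_{1,i-1}$ $(1\le i\le d)$, $a_i=p^i_{1i}$ $(0\le i\le d)$, $b_i=p^i_{1,i+1}$ $(0\le i\le d-1)$, $c_0=0$, $b_d=0$, and $k=b_0$ is the valency. The eigenvalues of $\Gamma$ are the distinct eigenvalues of its adjacency matrix; there are exactly $d+1$ of them, all real, $\theta_0>\theta_1>\cdots>\theta_d$, with $\theta_0=k$. $\Gamma$ is bipartite iff $a_i=0$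 for $0\le i\le d$. *)

theory Defs
  imports "HOL-Analysis.Analysis"
begin

text \<open>
  The vertex set of a graph is a finite type \<open>'v\<close> (so it is nonempty), and a graph is
  given by its adjacency relation \<open>E\<close>.
\<close>

definition connected_graph :: "('v::finite \<Rightarrow> 'v \<Rightarrow> bool) \<Rightarrow> bool" where
  "connected_graph E \<longleftrightarrow> irreflp E \<and> symp E \<and> (\<forall>x y. E\<^sup>*\<^sup>* x y)"

text \<open>\<open>(E ^^ n) x y\<close> says that there is a walk of length \<open>n\<close> from \<open>x\<close> to \<open>y\<close>.\<close>

definition graph_dist :: "('v::finite \<Rightarrow> 'v \<Rightarrow> bool) \<Rightarrow> 'v \<Rightarrow> 'v \<Rightarrow> nat" where
  "graph_dist E x y = (LEAST n. (E ^^ n) x y)"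

definition graph_diameter :: "('v::finite \<Rightarrow> 'v \<Rightarrow> bool) \<Rightarrow> nat" where
  "graph_diameter E = Max {graph_dist E x y |x y. True}"

definition graph_sphere :: "('v::finite \<Rightarrow> 'v \<Rightarrow> bool) \<Rightarrow> nat \<Rightarrow> 'v \<Rightarrow> 'v set" where
  "graph_sphere E i x = {y. graph_dist E x y = i}"

definition distance_regular :: "('v::finite \<Rightarrow> 'v \<Rightarrow> bool) \<Rightarrow> bool" where
  "distance_regular E \<longleftrightarrow> connected_graph E \<and>
     (\<forall>h \<le> graph_diameter E. \<forall>i \<le> graph_diameter E. \<forall>j \<le> graph_diameter E.
        \<exists>p. \<forall>x y. graph_dist E x y = h \<longrightarrow> card (graph_sphere E i x \<inter> graph_sphere E j y) = p)"

text \<open>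
  The value \<open>p\<^sup>h\<^sub>i\<^sub>j\<close>; meaningful for distance-regular \<open>E\<close> and \<open>h, i, j\<close> at most the diameter.
\<close>

definition intersection_number ::
    "('v::finite \<Rightarrow> 'v \<Rightarrow> bool) \<Rightarrow> nat \<Rightarrow> nat \<Rightarrow> nat \<Rightarrow> nat" where
  "intersection_number E h i j =
     (THE p. \<forall>x y. graph_dist E x y = h \<longrightarrow> card (graph_sphere E i x \<inter> graph_sphere E j y) = p)"

definition isect_a :: "('v::finite \<Rightarrow> 'v \<Rightarrow> bool) \<Rightarrow> nat \<Rightarrow> nat" where
  "isect_a E i = intersection_number E i 1 i"

definition isect_b :: "('v::finite \<Rightarrow> 'v \<Rightarrow> bool) \<Rightarrow> nat \<Rightarrow> nat" where
  "isect_b E i = (if i < graph_diameter E then intersection_number E i 1 (i + 1) else 0)"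

definition valency :: "('v::finite \<Rightarrow> 'v \<Rightarrow> bool) \<Rightarrow> nat" where
  "valency E = isect_b E 0"

definition bipartite_graph :: "('v::finite \<Rightarrow> 'v \<Rightarrow> bool) \<Rightarrow> bool" where
  "bipartite_graph E \<longleftrightarrow> (\<exists>C. \<forall>x y. E x y \<longrightarrow> (x \<in> C \<longleftrightarrow> y \<notin> C))"

definition adjacency_matrix :: "('v::finite \<Rightarrow> 'v \<Rightarrow> bool) \<Rightarrow> real^'v^'v" where
  "adjacency_matrix E = (\<chi> x y. if E x y then 1 else 0)"

definition graph_eigenvalues :: "('v::finite \<Rightarrow> 'v \<Rightarrow> bool) \<Rightarrow> real set" where
  "graph_eigenvalues E = {\<theta>. \<exists>v. v \<noteq> 0 \<and> adjacency_matrix E *v v = \<theta> *s v}"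

text \<open>
  The distinct eigenvalues in decreasing order, counted from 0: \<open>graph_eigenvalue E i\<close> is
  \<open>\<theta>\<^sub>i\<close>. The list is the expected one by finiteness of the spectrum
  (\<open>finite_graph_eigenvalues\<close> below).
\<close>

definition graph_eigenvalue :: "('v::finite \<Rightarrow> 'v \<Rightarrow> bool) \<Rightarrow> nat \<Rightarrow> real" where
  "graph_eigenvalue E i = rev (sorted_list_of_set (graph_eigenvalues E)) ! i"

lemma finite_graph_eigenvalues:
  assumes "symp E"
  shows "finite (graph_eigenvalues E)"
proof -
  let ?A = "adjacency_matrix E"
  have tr: "transpose ?A = ?A"
    using assms by (auto simp: adjacency_matrix_def transpose_def vec_eq_iff dest: sympD)
  have "\<forall>t\<in>graph_eigenvalues E. \<exists>v. v \<noteq> 0 \<and> ?A *v v = t *s v"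
    by (auto simp: graph_eigenvalues_def)
  then obtain f where f: "\<And>t. t \<in> graph_eigenvalues E \<Longrightarrow> f t \<noteq> 0 \<and> ?A *v f t = t *s f t"
    by metis
  have orth: "f s \<bullet> f t = 0"
    if "s \<in> graph_eigenvalues E" "t \<in> graph_eigenvalues E" "s \<noteq> t" for s t
  proof -
    have "(?A *v f s) \<bullet> f t = f s \<bullet> (?A *v f t)"
      by (metis dot_lmul_matrix tr transpose_matrix_vector)
    then have "s * (f s \<bullet> f t) = t * (f s \<bullet> f t)"
      using f[OF that(1)] f[OF that(2)] by (simp add: scalar_mult_eq_scaleR)
    then show ?thesis using that(3) by simp
  qed
  have inj: "inj_on f (graph_eigenvalues E)"
    by (rule inj_onI) (metis f inner_eq_zero_iff orth)
  have "independent (f ` graph_eigenvalues E)"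
    by (rule pairwise_orthogonal_independent)
      (use f orth in \<open>force simp: pairwise_def orthogonal_def\<close>)+
  then have "finite (f ` graph_eigenvalues E)"
    by (rule independent_imp_finite)
  with inj show ?thesis by (simp add: finite_image_iff)
qed

lemma connected_graph_walk:
  assumes "connected_graph E"
  shows "(E ^^ graph_dist E x y) x y"
proof -
  have "\<exists>n. (E ^^ n) x y"
    using assms by (auto simp: connected_graph_def rtranclp_power)
  then show ?thesis unfolding graph_dist_def by (rule LeastI_ex)
qed

lemma graph_dist_le: "(E ^^ n) x y \<Longrightarrow> graph_dist E x y \<le> n"
  unfolding graph_dist_def by (rule Least_le)

lemma graph_dist_le_diameter: "graph_dist E x y \<le> graph_diameter E"
proof -
  have "{graph_dist E x y |x y. True} = (\<lambda>(x, y). graph_dist E x y) ` UNIV" by auto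
  then have "finite {graph_dist E x y |x y. True}" by simp
  then show ?thesis unfolding graph_diameter_def by (rule Max_ge) auto
qed

lemma graph_dist_eq_1:
  assumes "connected_graph E"
  shows "graph_dist E x y = 1 \<longleftrightarrow> E x y"
proof
  assume "graph_dist E x y = 1"
  then show "E x y" using connected_graph_walk[OF assms, of x y] by auto
next
  assume e: "E x y"
  have "x \<noteq> y" using e assms by (auto simp: connected_graph_def irreflp_def)
  then have "graph_dist E x y \<noteq> 0" using connected_graph_walk[OF assms, of x y] by (metis relpowp_0_E)
  moreover have "graph_dist E x y \<le> 1" using e by (intro graph_dist_le) auto
  ultimately show "graph_dist E x y = 1" by simp
qed

lemma graph_dist_sym:
  assumes "connected_graph E"
  shows "graph_dist E x y = graph_dist E y x"
proof -
  have "(E ^^ n) y x" if "(E ^^ n) x y" for n x y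
    using that
  proof (induction n arbitrary: y)
    case (Suc n)
    then obtain z where z: "(E ^^ n) x z" "E z y" by auto
    then have "E y z" using assms by (auto simp: connected_graph_def dest: sympD)
    then show ?case using Suc.IH[OF z(1)] by (rule relpowp_Suc_I2)
  qed auto
  then have "(E ^^ n) x y \<longleftrightarrow> (E ^^ n) y x" for n by blast
  then show ?thesis by (simp add: graph_dist_def)
qed

lemma intersection_number_eq:
  assumes "distance_regular E" "i \<le> graph_diameter E" "j \<le> graph_diameter E"
  shows "card (graph_sphere E i x \<inter> graph_sphere E j y)
    = intersection_number E (graph_dist E x y) i j"
proof -
  obtain p where p: "\<forall>u v. graph_dist E u v = graph_dist E x y \<longrightarrow>
      card (graph_sphere E i u \<inter> graph_sphere E j v) = p"
    using assms graph_dist_le_diameter[of E x y] unfolding distance_regular_def by blast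
  then have "intersection_number E (graph_dist E x y) i j = p"
    unfolding intersection_number_def by (intro the_equality) auto
  with p show ?thesis by auto
qed

lemma graph_diameter_attained: "\<exists>x y. graph_dist E x y = graph_diameter E"
proof -
  have "{graph_dist E x y |x y. True} = (\<lambda>(x, y). graph_dist E x y) ` UNIV" by auto
  then have "finite {graph_dist E x y |x y. True}" "{graph_dist E x y |x y. True} \<noteq> {}" by auto
  from Max_in[OF this] show ?thesis unfolding graph_diameter_def by fastforce
qed

lemma graph_dist_attained:
  assumes c: "connected_graph E" and "i \<le> graph_diameter E"
  shows "\<exists>x y. graph_dist E x y = i"
proof -
  obtain x y where xy: "graph_dist E x y = graph_diameter E" using graph_diameter_attained by blast
  obtain j where j: "graph_diameter E = i + j" using assms(2) le_Suc_ex by blast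
  have "(E ^^ (i + j)) x y" using connected_graph_walk[OF c, of x y] xy j by simp
  then obtain z where z: "(E ^^ i) x z" "(E ^^ j) z y" by (auto simp: relpowp_add)
  have "(E ^^ (graph_dist E x z + j)) x y"
    using connected_graph_walk[OF c, of x z] z(2) by (auto simp: relpowp_add)
  then have "i \<le> graph_dist E x z" using graph_dist_le xy j by fastforce
  then show ?thesis using graph_dist_le[OF z(1)] by (metis le_antisym)
qed

lemma bipartite_graph_iff_isect_a:
  assumes dr: "distance_regular E"
  shows "bipartite_graph E \<longleftrightarrow> (\<forall>i \<le> graph_diameter E. isect_a E i = 0)"
proof
  have c: "connected_graph E" using dr by (simp add: distance_regular_def)
  have d1: "1 \<le> graph_diameter E" if "E x z" for x z
    using that graph_dist_eq_1[OF c] graph_dist_le_diameter by metis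
  assume "bipartite_graph E"
  then obtain C where C: "\<And>x y. E x y \<Longrightarrow> x \<in> C \<longleftrightarrow> y \<notin> C"
    unfolding bipartite_graph_def by blast
  have par: "(x \<in> C \<longleftrightarrow> y \<in> C) \<longleftrightarrow> even n" if "(E ^^ n) x y" for n x y
    using that by (induction n arbitrary: y) (auto dest: C)
  show "\<forall>i \<le> graph_diameter E. isect_a E i = 0"
  proof (intro allI impI)
    fix i assume i: "i \<le> graph_diameter E"
    obtain x y where xy: "graph_dist E x y = i" using graph_dist_attained[OF c i] by blast
    have e: "graph_sphere E 1 x \<inter> graph_sphere E i y = {}"
    proof (rule ccontr)
      assume "\<not> ?thesis"
      then obtain z where z: "graph_dist E x z = 1" "graph_dist E y z = i"
        by (auto simp: graph_sphere_def)
      then have "E x z" using graph_dist_eq_1[OF c] by blast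
      then show False
        using C par[OF connected_graph_walk[OF c, of x y]] par[OF connected_graph_walk[OF c, of y z]]
          z xy by metis
    qed
    show "isect_a E i = 0"
    proof (cases "1 \<le> graph_diameter E")
      case True
      then show ?thesis using intersection_number_eq[OF dr True i, of x y] xy e by (simp add: isect_a_def)
    next
      case False
      have s: "graph_sphere E 1 u = {}" for u
        unfolding graph_sphere_def using False graph_dist_le_diameter[of E u] by (metis (mono_tags, lifting) empty_Collect_eq)
      have "intersection_number E i 1 i = 0"
        unfolding intersection_number_def s using xy by (intro the_equality) auto
      then show ?thesis by (simp add: isect_a_def)
    qed
  qed
next
  have c: "connected_graph E" using dr by (simp add: distance_regular_def)
  assume a: "\<forall>i \<le> graph_diameter E. isect_a E i = 0"
  obtain o' :: 'a where True by blast
  have no: "graph_dist E x o' \<noteq> graph_dist E z o'" if e: "E x z" for x z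
  proof
    assume eq: "graph_dist E x o' = graph_dist E z o'"
    have 1: "graph_dist E x z = 1" using e graph_dist_eq_1[OF c] by blast
    then have d1: "1 \<le> graph_diameter E" using graph_dist_le_diameter by metis
    have "z \<in> graph_sphere E 1 x \<inter> graph_sphere E (graph_dist E x o') o'"
      using 1 eq graph_dist_sym[OF c, of z o'] by (simp add: graph_sphere_def)
    then have "card (graph_sphere E 1 x \<inter> graph_sphere E (graph_dist E x o') o') \<noteq> 0"
      by (auto simp: card_eq_0_iff)
    moreover have "card (graph_sphere E 1 x \<inter> graph_sphere E (graph_dist E x o') o') = 0"
      using a intersection_number_eq[OF dr d1 graph_dist_le_diameter, of x x o' o']
        graph_dist_le_diameter[of E x o'] by (simp add: isect_a_def)
    ultimately show False by simp
  qed
  have le: "graph_dist E x o' \<le> Suc (graph_dist E z o')" if "E x z" for x z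
    using relpowp_Suc_I2[where P = E, OF that connected_graph_walk[OF c, of z o']] by (rule graph_dist_le)
  have "even (graph_dist E x o') \<longleftrightarrow> odd (graph_dist E z o')" if e: "E x z" for x z
  proof -
    have "E z x" using e c by (auto simp: connected_graph_def dest: sympD)
    then have "graph_dist E x o' = Suc (graph_dist E z o') \<or> graph_dist E z o' = Suc (graph_dist E x o')"
      using le[OF e] le[of z x] no[OF e] by linarith
    then show ?thesis by auto
  qed
  then show "bipartite_graph E"
    unfolding bipartite_graph_def by (intro exI[of _ "{x. even (graph_dist E x o')}"]) auto
qed

end

theory Submission
  imports Defs
begin

text \<open>
  Fix an eigenvalue \<open>t\<close>. The normalized eigenvector for \<open>t\<close> that is constant on the spheres about a
  vertex gives the cosine sequence \<open>u\<close> of \<open>t\<close>, with \<open>u 0 = 1\<close> and \<open>u 1 = t / k\<close>. The matrix with entries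
  \<open>u (\<partial> a b)\<close> is a positive multiple of a projection, so up to a positive factor it is the Gram
  matrix of vectors \<open>r a\<close> indexed by the vertices (\<open>cosine_gram_representation\<close>).

  Now fix an edge \<open>x y\<close>, and let \<open>R\<close> be the sum of \<open>r z\<close> over its common neighbours \<open>z\<close>. Any two common
  neighbours have distance at most \<open>2\<close>. Hence all inner products among \<open>r x\<close>, \<open>r y\<close> and \<open>R\<close> are expressed
  by \<open>t\<close>, \<open>k\<close>, \<open>a\<^sub>1\<close>, \<open>b\<^sub>1 = k - 1 - a\<^sub>1\<close> and the number \<open>n\<close> of ordered pairs of common neighbours at distance \<open>2\<close>. That the
  component of \<open>R\<close> orthogonal to \<open>r x\<close> and \<open>r y\<close> has nonnegative squared length reads, for \<open>- k < t < k\<close>,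
  \<open>n (k + t) (1 + t) \<le> a\<^sub>1 b\<^sub>1 (k + t (a\<^sub>1 + 1))\<close> (\<open>edge_inequality\<close>).
  Here \<open>n\<close> is the same for all \<open>t\<close>. Dividing by \<open>a\<^sub>1 b\<^sub>1 (k + t) (1 + t)\<close> bounds \<open>n / (a\<^sub>1 b\<^sub>1)\<close> from above if \<open>t > - 1\<close> and
  from below if \<open>t < - 1\<close>. Applied to \<open>\<theta>\<^sub>1\<close> and \<open>\<theta>\<^sub>d\<close>, this sandwich is the first claim for \<open>a\<^sub>1 > 0\<close>; for
  \<open>a\<^sub>1 = 0\<close> the two sides have opposite signs. Clearing
  denominators and cancelling \<open>\<theta>\<^sub>1 - \<theta>\<^sub>d\<close> turns the first claim into the second, while a bipartite graph
  has \<open>a\<^sub>1 = 0\<close>, which makes the right-hand side of the second claim zero and its left-hand side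
  a product of two nonnegative factors.

  It remains to locate the eigenvalues: \<open>\<theta>\<^sub>1 > - 1\<close> and \<open>\<theta>\<^sub>d < - 1\<close> by test vectors
  (\<open>theta_1_nonneg\<close>, \<open>theta_d_less\<close>), and \<open>\<theta>\<^sub>d > - k\<close> unless the graph is bipartite
  (\<open>bipartite_if_minus_valency\<close>). That \<open>\<theta>\<^sub>d\<close> is the least eigenvalue rests on there being exactly
  \<open>d + 1\<close> of them (\<open>card_eigenvalues\<close>).
\<close>

section \<open>Eigenvectors of self-adjoint maps\<close>

text \<open>
  The Rayleigh quotient attains its maximum on the unit sphere of \<open>S\<close>, and a point where it does is
  an eigenvector. It is used in two ways: to produce eigenvectors inside invariant subspaces,
  and to bound an extreme eigenvalue by a test vector.
\<close>

lemma selfadjoint_max_eigenvector: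
  fixes f :: "'a::euclidean_space \<Rightarrow> 'a"
  assumes lin: "linear f" and sa: "\<And>x y. f x \<bullet> y = x \<bullet> f y"
    and S: "subspace S" and inv: "\<And>x. x \<in> S \<Longrightarrow> f x \<in> S"
    and w0: "w0 \<in> S" "w0 \<noteq> 0"
  obtains v l where "v \<in> S" "v \<noteq> 0" "f v = l *\<^sub>R v" "\<And>w. w \<in> S \<Longrightarrow> w \<bullet> f w \<le> l * (w \<bullet> w)"
proof -
  interpret linear f by (rule lin)
  let ?K = "S \<inter> sphere 0 1"
  have "compact ?K"
    by (simp add: closed_Int_compact closed_subspace S)
  moreover have "w0 /\<^sub>R norm w0 \<in> ?K"
    using w0 S by (simp add: subspace_scale)
  moreover have "continuous_on ?K (\<lambda>x. x \<bullet> f x)"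
    by (intro continuous_on_inner continuous_on_id linear_continuous_on linear_conv_bounded_linear[THEN iffD1] lin)
  ultimately obtain v where v: "v \<in> ?K" and vmax: "\<And>w. w \<in> ?K \<Longrightarrow> w \<bullet> f w \<le> v \<bullet> f v"
    using continuous_attains_sup[of ?K "\<lambda>x. x \<bullet> f x"] by blast
  define l where "l = v \<bullet> f v"
  have vv: "v \<bullet> v = 1" and vS: "v \<in> S" using v by (auto simp: dot_square_norm)
  have le: "w \<bullet> f w \<le> l * (w \<bullet> w)" if "w \<in> S" for w
  proof (cases "w = 0")
    case False
    have "w /\<^sub>R norm w \<in> ?K" using that S False by (simp add: subspace_scale)
    from vmax[OF this] have "(w \<bullet> f w) / (norm w * norm w) \<le> l"
      by (simp add: scale l_def divide_simps)
    then show ?thesis using False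
      by (simp add: dot_square_norm power2_eq_square pos_divide_le_eq)
  qed (simp add: zero)
  \<comment> \<open>The form \<open>l * (w \<bullet> w) - w \<bullet> f w\<close> is nonnegative on \<open>S\<close> and vanishes at \<open>v\<close>, so its
    derivative at \<open>v\<close> in the direction \<open>w = l v - f v\<close>, which is \<open>2 (w \<bullet> w)\<close>, is zero.\<close>
  define w where "w = l *\<^sub>R v - f v"
  have wS: "w \<in> S" unfolding w_def using S vS inv by (simp add: subspace_diff subspace_scale)
  define q where "q = l * (w \<bullet> w) - w \<bullet> f w"
  have ineq: "0 \<le> 2 * t * (w \<bullet> w) + t\<^sup>2 * q" for t
  proof -
    have "v + t *\<^sub>R w \<in> S" using S vS wS by (simp add: subspace_add subspace_scale)
    from le[OF this] have "0 \<le> l * ((v + t *\<^sub>R w) \<bullet> (v + t *\<^sub>R w)) - (v + t *\<^sub>R w) \<bullet> f (v + t *\<^sub>R w)"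
      by simp
    also have "\<dots> = 2 * t * (l * (v \<bullet> w) - f v \<bullet> w) + t\<^sup>2 * q"
      using sa[of v w] sa[of w v] vv
      by (simp add: q_def add scale inner_simps l_def[symmetric] inner_commute power2_eq_square algebra_simps)
    also have "l * (v \<bullet> w) - f v \<bullet> w = w \<bullet> w" by (simp add: w_def inner_simps inner_commute algebra_simps)
    finally show ?thesis .
  qed
  have "w \<bullet> w = 0"
  proof (rule ccontr)
    assume "w \<bullet> w \<noteq> 0"
    then have p: "w \<bullet> w > 0" by simp
    define t where "t = - (w \<bullet> w) / (\<bar>q\<bar> + 1)"
    have t: "t < 0" "- t * (\<bar>q\<bar> + 1) = w \<bullet> w" using p by (auto simp: t_def)
    have "- t * q \<le> - t * \<bar>q\<bar>" using t(1) by (intro mult_left_mono) auto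
    also have "\<dots> = w \<bullet> w + t" using t(2) unfolding distrib_left by linarith
    also have "\<dots> < 2 * (w \<bullet> w)" using t(1) p by linarith
    finally have "0 < 2 * (w \<bullet> w) + t * q" by simp
    then have "t * (2 * (w \<bullet> w) + t * q) < 0" using t(1) by (simp add: mult_neg_pos)
    then show False using ineq[of t] by (simp add: power2_eq_square algebra_simps)
  qed
  then have "f v = l *\<^sub>R v" by (simp add: w_def)
  then show thesis using that[of v l] vS vv le by force
qed

section \<open>Distances and the adjacency matrix\<close>

locale distance_regular_graph =
  fixes E :: "'v::finite \<Rightarrow> 'v \<Rightarrow> bool"
  assumes dr: "distance_regular E"
begin

abbreviation gdist ("\<partial>") where "gdist \<equiv> graph_dist E"
abbreviation d where "d \<equiv> graph_diameter E"
abbreviation p where "p \<equiv> intersection_number E"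
abbreviation A where "A \<equiv> adjacency_matrix E"

lemma conn: "connected_graph E"
  using dr by (simp add: distance_regular_def)

lemma adj_sym: "E x y \<longleftrightarrow> E y x"
  using conn by (auto simp: connected_graph_def dest: sympD)

lemma adj_irrefl: "\<not> E x x"
  using conn by (auto simp: connected_graph_def irreflp_def)

lemma dist_sym: "\<partial> x y = \<partial> y x"
  by (rule graph_dist_sym[OF conn])

lemma dist_1: "\<partial> x y = Suc 0 \<longleftrightarrow> E x y"
  using graph_dist_eq_1[OF conn] by simp

lemma dist_0: "\<partial> x y = 0 \<longleftrightarrow> x = y"
proof
  assume "\<partial> x y = 0"
  then show "x = y" using connected_graph_walk[OF conn, of x y] by simp
next
  assume "x = y"
  then have "(E ^^ 0) x y" by simp
  from graph_dist_le[OF this] show "\<partial> x y = 0" by simp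
qed

lemma dist_self [simp]: "\<partial> x x = 0"
  by (simp add: dist_0)

lemma dist_step: "E y z \<Longrightarrow> \<partial> x z \<le> Suc (\<partial> x y)"
  using connected_graph_walk[OF conn, of x y] by (intro graph_dist_le) auto

lemma dist_pred:
  assumes "\<partial> x y = Suc i"
  obtains z where "\<partial> x z = i" "E z y"
proof -
  have "(E ^^ Suc i) x y" using connected_graph_walk[OF conn, of x y] assms by simp
  then obtain z where z: "(E ^^ i) x z" "E z y" by auto
  have "\<partial> x z = i" using graph_dist_le[OF z(1)] dist_step[OF z(2), of x] assms by simp
  then show thesis using z(2) that by blast
qed

lemma A_apply: "(A *v v) $ x = (\<Sum>z | E x z. v $ z)"
  by (simp add: matrix_vector_mult_def adjacency_matrix_def if_distrib[of "\<lambda>t. t * _"] sum.If_cases Int_def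
      cong: if_cong)

lemma A_selfadjoint: "(A *v v) \<bullet> w = v \<bullet> (A *v w)"
proof -
  have "transpose A = A"
    by (auto simp: adjacency_matrix_def transpose_def vec_eq_iff adj_sym)
  then show ?thesis by (metis dot_lmul_matrix transpose_matrix_vector)
qed

lemma A_linear: "linear ((*v) A)"
  by (rule matrix_vector_mul_linear)

lemma eigenvalue_iff: "t \<in> graph_eigenvalues E \<longleftrightarrow> (\<exists>v. v \<noteq> 0 \<and> A *v v = t *\<^sub>R v)"
  by (simp add: graph_eigenvalues_def scalar_mult_eq_scaleR)

text \<open>
  Sorting the vertices \<open>z\<close> by their distances to \<open>x\<close> and \<open>y\<close> turns the sum into one over
  intersection numbers. Hence it depends on \<open>x\<close> and \<open>y\<close> only through their distance.
\<close>

lemma sum_over_pairs_of_distances: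
  fixes F :: "nat \<Rightarrow> nat \<Rightarrow> real"
  shows "(\<Sum>z\<in>UNIV. F (\<partial> x z) (\<partial> y z)) = (\<Sum>i\<le>d. \<Sum>j\<le>d. F i j * real (p (\<partial> x y) i j))"
proof -
  have "(\<Sum>z\<in>UNIV. F (\<partial> x z) (\<partial> y z)) =
    (\<Sum>z\<in>UNIV. \<Sum>i\<le>d. \<Sum>j\<le>d. if \<partial> x z = i \<and> \<partial> y z = j then F i j else 0)"
  proof (rule sum.cong[OF refl])
    fix z
    have "(\<Sum>j\<le>d. if \<partial> x z = i \<and> \<partial> y z = j then F i j else 0)
      = (if \<partial> x z = i then F i (\<partial> y z) else 0)" for i
      using graph_dist_le_diameter[of E y z] by (simp add: sum.delta)
    then show "F (\<partial> x z) (\<partial> y z)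
      = (\<Sum>i\<le>d. \<Sum>j\<le>d. if \<partial> x z = i \<and> \<partial> y z = j then F i j else 0)"
      using graph_dist_le_diameter[of E x z] by (simp add: sum.delta)
  qed
  also have "\<dots> = (\<Sum>i\<le>d. \<Sum>j\<le>d. \<Sum>z\<in>UNIV. if \<partial> x z = i \<and> \<partial> y z = j then F i j else 0)"
    by (subst sum.swap, intro sum.cong refl, rule sum.swap)
  also have "\<dots> = (\<Sum>i\<le>d. \<Sum>j\<le>d. F i j * real (p (\<partial> x y) i j))"
  proof (intro sum.cong refl)
    fix i j assume ij: "i \<in> {..d}" "j \<in> {..d}"
    have "(\<Sum>z\<in>UNIV. if \<partial> x z = i \<and> \<partial> y z = j then F i j else 0)
      = F i j * real (card (graph_sphere E i x \<inter> graph_sphere E j y))"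
      by (simp add: sum.If_cases graph_sphere_def Collect_conj_eq)
    then show "(\<Sum>z\<in>UNIV. if \<partial> x z = i \<and> \<partial> y z = j then F i j else 0)
      = F i j * real (p (\<partial> x y) i j)"
      using intersection_number_eq[OF dr] ij by simp
  qed
  finally show ?thesis .
qed

lemma radial_nbr_sum_cong:
  fixes g :: "nat \<Rightarrow> real"
  assumes "\<partial> x y = \<partial> x' y'"
  shows "(\<Sum>z | E y z. g (\<partial> x z)) = (\<Sum>z | E y' z. g (\<partial> x' z))"
proof -
  have "(\<Sum>z | E y z. g (\<partial> x z)) = (\<Sum>z\<in>UNIV. if \<partial> y z = 1 then g (\<partial> x z) else 0)" for x y
    by (simp add: sum.If_cases dist_1)
  then show ?thesis
    using sum_over_pairs_of_distances[of "\<lambda>i j. if j = 1 then g i else 0"] assms by simp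
qed

text \<open>
  Some sphere of radius \<open>i\<close> is nonempty, and all spheres of that radius have the same size.
\<close>

lemma sphere_nonempty:
  assumes "i \<le> d"
  obtains y where "\<partial> x y = i"
proof -
  obtain a b where ab: "\<partial> a b = i" using graph_dist_attained[OF conn assms] by blast
  have "card (graph_sphere E i a \<inter> graph_sphere E i a) = card (graph_sphere E i x \<inter> graph_sphere E i x)"
    using intersection_number_eq[OF dr assms assms, of a a] intersection_number_eq[OF dr assms assms, of x x]
    by simp
  moreover have "b \<in> graph_sphere E i a" using ab by (simp add: graph_sphere_def)
  ultimately have "graph_sphere E i x \<noteq> {}" by (metis Int_absorb card_0_eq empty_iff finite card.empty)
  then show thesis using that by (auto simp: graph_sphere_def)
qed

section \<open>Radial vectors\<close>

text \<open>
  The vectors that are constant on the spheres about \<open>x\<close>. They form a subspace of dimension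
  \<open>d + 1\<close>, invariant under the adjacency matrix, on which every eigenvalue has multiplicity one.
\<close>

definition radial :: "'v \<Rightarrow> (real^'v) set" where
  "radial x = {v. \<exists>g. \<forall>y. v $ y = g (\<partial> x y)}"

lemma subspace_radial: "subspace (radial x)"
proof (rule subspaceI)
  show "0 \<in> radial x" unfolding radial_def by (auto intro!: exI[of _ "\<lambda>_. 0"])
next
  fix v w assume "v \<in> radial x" "w \<in> radial x"
  then obtain g h where "\<forall>y. v $ y = g (\<partial> x y)" "\<forall>y. w $ y = h (\<partial> x y)"
    by (auto simp: radial_def)
  then show "v + w \<in> radial x"
    unfolding radial_def by (auto intro!: exI[of _ "\<lambda>i. g i + h i"])
next
  fix v and c :: real assume "v \<in> radial x"
  then obtain g where "\<forall>y. v $ y = g (\<partial> x y)" by (auto simp: radial_def)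
  then show "c *\<^sub>R v \<in> radial x"
    unfolding radial_def by (auto intro!: exI[of _ "\<lambda>i. c * g i"])
qed

lemma radial_vec [simp]: "(\<chi> y. g (\<partial> x y)) \<in> radial x"
  unfolding radial_def by auto

lemma radialE:
  assumes "v \<in> radial x"
  obtains g where "v = (\<chi> y. g (\<partial> x y))"
  using assms by (auto simp: radial_def vec_eq_iff)

lemma radial_if_depends_on_dist:
  assumes "\<And>y z. \<partial> x y = \<partial> x z \<Longrightarrow> v $ y = v $ z"
  shows "v \<in> radial x"
proof -
  have "v $ y = v $ (SOME z. \<partial> x z = \<partial> x y)" for y
    by (rule assms) (metis (mono_tags, lifting) someI)
  then show ?thesis unfolding radial_def
    by (auto intro!: exI[of _ "\<lambda>i. v $ (SOME z. \<partial> x z = i)"])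
qed

lemma A_radial:
  assumes "v \<in> radial x"
  shows "A *v v \<in> radial x"
proof -
  from assms obtain g where v: "v = (\<chi> y. g (\<partial> x y))" by (rule radialE)
  show ?thesis
    by (rule radial_if_depends_on_dist) (simp only: A_apply v vec_lambda_beta, rule radial_nbr_sum_cong)
qed

text \<open>
  A vertex at distance \<open>i\<close> from \<open>x\<close> has neighbours at distance at most \<open>i + 1\<close> only, and so the
  eigenvalue equation determines the value at distance \<open>i + 1\<close> from the earlier ones. Thus the
  value at \<open>x\<close> determines a radial eigenvector.
\<close>

lemma radial_eigenvector_zero:
  assumes v: "v \<in> radial x" and ev: "A *v v = t *\<^sub>R v" and z: "v $ x = 0"
  shows "v = 0"
proof -
  from v obtain g where g: "v = (\<chi> y. g (\<partial> x y))" by (rule radialE)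
  have "v $ y = 0" for y
  proof (induction "\<partial> x y" arbitrary: y rule: less_induct)
    case (less y)
    show ?case
    proof (cases "\<partial> x y")
      case 0
      then show ?thesis using z dist_0 by metis
    next
      case (Suc i)
      then obtain b where b: "\<partial> x b = i" "E b y" by (rule dist_pred)
      let ?N = "{z. E b z \<and> \<partial> x z = Suc i}"
      have "0 = (A *v v) $ b" using less[of b] b Suc by (simp add: ev)
      also have "\<dots> = (\<Sum>z\<in>?N. v $ z)"
      proof -
        have "v $ z = 0" if "E b z" "\<partial> x z \<noteq> Suc i" for z
          using dist_step[OF that(1), of x] that b Suc less[of z] by simp
        then show ?thesis unfolding A_apply by (intro sum.mono_neutral_right) auto
      qed
      also have "\<dots> = (\<Sum>z\<in>?N. v $ y)" using Suc by (intro sum.cong refl) (simp add: g)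
      finally have "real (card ?N) * v $ y = 0" by simp
      moreover have "y \<in> ?N" using b Suc by simp
      ultimately show ?thesis by (auto simp: card_eq_0_iff)
    qed
  qed
  then show ?thesis by (simp add: vec_eq_iff)
qed

text \<open>
  The orthogonal projection of the eigenvector onto the radial vectors is an eigenvector, because
  these form an invariant subspace of a self-adjoint map. It does not vanish at \<open>x\<close>, since
  the indicator vector of \<open>x\<close> is radial.
\<close>

lemma radial_eigenvector_exists:
  assumes v: "v $ x \<noteq> 0" and ev: "A *v v = t *\<^sub>R v"
  obtains w where "w \<in> radial x" "w $ x = 1" "A *v w = t *\<^sub>R w"
proof -
  have sp: "span (radial x) = radial x" by (simp add: span_eq_iff subspace_radial)
  obtain y z where y: "y \<in> radial x" and z: "\<And>w. w \<in> radial x \<Longrightarrow> z \<bullet> w = 0" and vyz: "v = y + z"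
    using orthogonal_subspace_decomp_exists[of "radial x" v] unfolding sp orthogonal_def by metis
  define r where "r = A *v y - t *\<^sub>R y"
  have rR: "r \<in> radial x"
    unfolding r_def by (intro subspace_diff subspace_scale subspace_radial A_radial y)
  have "r = t *\<^sub>R z - A *v z"
    using ev unfolding r_def vyz by (simp add: matrix_vector_right_distrib algebra_simps)
  then have "r \<bullet> r = t * (z \<bullet> r) - z \<bullet> (A *v r)"
    by (simp add: inner_diff_left A_selfadjoint)
  then have "r = 0" using z[OF rR] z[OF A_radial[OF rR]] by simp
  then have Ay: "A *v y = t *\<^sub>R y" by (simp add: r_def)
  have "(axis x 1 :: real^'v) \<in> radial x"
    unfolding radial_def by (auto simp: axis_def dist_0 intro!: exI[of _ "\<lambda>i. if i = 0 then 1 else 0"])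
  from z[OF this] have "z $ x = 0" by (simp add: inner_axis)
  then have yx: "y $ x \<noteq> 0" using v vyz by simp
  show thesis
  proof
    show "(1 / y $ x) *\<^sub>R y \<in> radial x" by (intro subspace_scale subspace_radial y)
    show "((1 / y $ x) *\<^sub>R y) $ x = 1" using yx by simp
    show "A *v ((1 / y $ x) *\<^sub>R y) = t *\<^sub>R ((1 / y $ x) *\<^sub>R y)"
      using Ay by (simp add: linear_scale[OF A_linear])
  qed
qed

section \<open>Cosine sequences\<close>

text \<open>
  The values of the normalized radial eigenvector for \<open>t\<close>. By distance-regularity the same
  sequence gives a radial eigenvector about every vertex \<open>a\<close>.
\<close>

lemma cosine_sequence_exists:
  assumes "t \<in> graph_eigenvalues E"
  obtains u :: "nat \<Rightarrow> real" where "u 0 = 1"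
    and "\<And>a b. (\<Sum>z | E b z. u (\<partial> a z)) = t * u (\<partial> a b)"
proof -
  obtain v where v: "v \<noteq> 0" "A *v v = t *\<^sub>R v" using assms by (auto simp: eigenvalue_iff)
  then obtain x where "v $ x \<noteq> 0" by (auto simp: vec_eq_iff)
  from radial_eigenvector_exists[OF this v(2)]
  obtain w where w: "w \<in> radial x" "w $ x = 1" "A *v w = t *\<^sub>R w" by blast
  from w(1) obtain u where u: "w = (\<chi> y. u (\<partial> x y))" by (rule radialE)
  have "(\<Sum>z | E b z. u (\<partial> a z)) = t * u (\<partial> a b)" for a b
  proof -
    obtain y where y: "\<partial> x y = \<partial> a b" using sphere_nonempty[OF graph_dist_le_diameter] by blast
    have "(\<Sum>z | E b z. u (\<partial> a z)) = (\<Sum>z | E y z. u (\<partial> x z))"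
      using y by (intro radial_nbr_sum_cong) simp
    also have "\<dots> = (A *v w) $ y" by (simp add: A_apply u)
    also have "\<dots> = t * u (\<partial> a b)" unfolding w(3) by (simp add: u y)
    finally show ?thesis .
  qed
  moreover have "u 0 = 1" using w(2) by (simp add: u)
  ultimately show thesis using that by blast
qed

text \<open>
  The matrix \<open>M\<close> with entries \<open>u (\<partial> a b)\<close> is, up to a positive factor, the projection onto an
  eigenspace: the columns of its square are again radial eigenvectors for \<open>t\<close>, hence multiples of
  those of \<open>M\<close>. As \<open>M\<close> is symmetric, this presents it, up to the factor \<open>\<gamma>\<close>, as the Gram matrix
  of its own rows.
\<close>

lemma cosine_gram_representation:
  fixes u :: "nat \<Rightarrow> real"
  assumes u0: "u 0 = 1" and u: "\<And>a b. (\<Sum>z | E b z. u (\<partial> a z)) = t * u (\<partial> a b)"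
  obtains r :: "'v \<Rightarrow> real^'v" and \<gamma> :: real
  where "\<gamma> > 0" "\<And>a b. r a \<bullet> r b = \<gamma> * u (\<partial> a b)"
proof -
  define r :: "'v \<Rightarrow> real^'v" where "r a = (\<chi> z. u (\<partial> a z))" for a
  define G where "G h = (\<Sum>i\<le>d. \<Sum>j\<le>d. u i * u j * real (p h i j))" for h
  have rr: "r a \<bullet> r b = G (\<partial> a b)" for a b
    using sum_over_pairs_of_distances[of "\<lambda>i j. u i * u j" a b]
    by (simp add: r_def inner_vec_def G_def)
  have r_nbr: "(\<Sum>z | E b z. r z) = t *\<^sub>R r b" for b
    using u by (simp add: vec_eq_iff r_def dist_sym)
  have gram: "r a \<bullet> r b = G 0 * u (\<partial> a b)" for a b
  proof -
    define w where "w = (\<chi> c. G (\<partial> a c)) - G 0 *\<^sub>R r a"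
    have "w \<in> radial a"
      unfolding w_def r_def by (intro subspace_diff subspace_scale subspace_radial radial_vec)
    moreover have "A *v w = t *\<^sub>R w"
    proof -
      have "A *v (\<chi> c. G (\<partial> a c)) = t *\<^sub>R (\<chi> c. G (\<partial> a c))"
      proof -
        have "(\<Sum>z | E c z. G (\<partial> a z)) = t * G (\<partial> a c)" for c
          using r_nbr[of c] by (simp add: rr[symmetric] flip: inner_sum_right)
        then show ?thesis by (simp add: vec_eq_iff A_apply)
      qed
      moreover have "A *v r a = t *\<^sub>R r a"
        using u by (simp add: vec_eq_iff A_apply r_def)
      ultimately show ?thesis
        by (simp add: w_def linear_diff[OF A_linear] linear_scale[OF A_linear] algebra_simps)
    qed
    moreover have "w $ a = 0" by (simp add: w_def r_def u0)
    ultimately have "w = 0" by (rule radial_eigenvector_zero)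
    then have "w $ b = 0" by simp
    then show ?thesis unfolding rr by (simp add: w_def r_def)
  qed
  have "G 0 > 0"
  proof -
    fix a :: 'v
    have "r a $ a = 1" by (simp add: r_def u0)
    then have "r a \<noteq> 0" by auto
    then show ?thesis using rr[of a a] by (metis dist_self inner_gt_zero_iff)
  qed
  with gram show thesis using that by blast
qed

section \<open>The number of eigenvalues\<close>

text \<open>
  The indicator vectors of the spheres about \<open>x\<close> are an orthogonal basis.
\<close>

lemma dim_radial: "dim (radial x) = d + 1"
proof -
  define s :: "nat \<Rightarrow> real^'v" where "s i = (\<chi> y. if \<partial> x y = i then 1 else 0)" for i
  have s_inner: "s i \<bullet> v = (\<Sum>y | \<partial> x y = i. v $ y)" for i v
    by (simp add: inner_vec_def s_def sum.If_cases if_distrib[of "\<lambda>t. t * _"] cong: if_cong)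
  have orth: "s i \<bullet> s j = 0" if "i \<noteq> j" for i j
    using that unfolding s_inner by (auto simp: s_def intro: sum.neutral)
  have nz: "s i \<noteq> 0" if i: "i \<le> d" for i
  proof -
    obtain y where "\<partial> x y = i" using sphere_nonempty[OF i] by blast
    then have "s i $ y = 1" by (simp add: s_def)
    then show ?thesis by auto
  qed
  have inj: "inj_on s {..d}"
  proof (rule inj_onI)
    fix i j assume "i \<in> {..d}" "j \<in> {..d}" "s i = s j"
    then show "i = j" using orth[of i j] nz[of i] by auto
  qed
  have "independent (s ` {..d})"
  proof (rule pairwise_orthogonal_independent)
    show "pairwise orthogonal (s ` {..d})"
      by (auto simp: pairwise_image pairwise_def orthogonal_def intro!: orth)
    show "0 \<notin> s ` {..d}" using nz by force
  qed
  moreover have "s ` {..d} \<subseteq> radial x" 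
    using radial_vec[of "\<lambda>j. if j = _ then 1 else 0" x] by (auto simp: s_def)
  moreover have "radial x \<subseteq> span (s ` {..d})"
  proof
    fix v assume "v \<in> radial x"
    then obtain g where "v = (\<chi> y. g (\<partial> x y))" by (rule radialE)
    then have "v = (\<Sum>i\<le>d. g i *\<^sub>R s i)"
      using graph_dist_le_diameter[of E x]
      by (simp add: vec_eq_iff s_def if_distrib[of "\<lambda>t. _ * t"] cong: if_cong)
    moreover have "(\<Sum>i\<le>d. g i *\<^sub>R s i) \<in> span (s ` {..d})"
      by (intro span_sum span_scale span_base imageI)
    ultimately show "v \<in> span (s ` {..d})" by simp
  qed
  ultimately have "card (s ` {..d}) = dim (radial x)" by (intro basis_card_eq_dim)
  then show ?thesis using inj by (simp add: card_image)
qed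

lemma finite_eigenvalues: "finite (graph_eigenvalues E)"
  using finite_graph_eigenvalues[of E] conn by (simp add: connected_graph_def)

text \<open>
  The radial eigenvectors about a vertex \<open>x\<close>, one for each eigenvalue, form a basis of the radial
  vectors. In particular \<open>graph_eigenvalue E d\<close> is the least eigenvalue.
\<close>

lemma card_eigenvalues: "card (graph_eigenvalues E) = d + 1"
proof -
  let ?T = "graph_eigenvalues E"
  fix x :: 'v
  have "\<exists>w. w \<in> radial x \<and> w $ x = 1 \<and> A *v w = t *\<^sub>R w" if t: "t \<in> ?T" for t
  proof -
    obtain u where u: "u 0 = 1" "\<And>a b. (\<Sum>z | E b z. u (\<partial> a z)) = t * u (\<partial> a b)"
      using cosine_sequence_exists[OF t] by blast
    show ?thesis
      by (rule exI[of _ "\<chi> y. u (\<partial> x y)"]) (simp add: u vec_eq_iff A_apply)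
  qed
  then obtain w where wR: "\<And>t. t \<in> ?T \<Longrightarrow> w t \<in> radial x" and w1: "\<And>t. t \<in> ?T \<Longrightarrow> w t $ x = 1"
    and wev: "\<And>t. t \<in> ?T \<Longrightarrow> A *v w t = t *\<^sub>R w t" by metis
  have nz: "w t \<noteq> 0" if "t \<in> ?T" for t using w1[OF that] by auto
  have orth: "w s \<bullet> w t = 0" if "s \<in> ?T" "t \<in> ?T" "s \<noteq> t" for s t
    using A_selfadjoint[of "w s" "w t"] wev that by simp
  have inj: "inj_on w ?T"
  proof (rule inj_onI)
    fix a b assume "a \<in> ?T" "b \<in> ?T" "w a = w b"
    then show "a = b" using orth[of a b] nz[of a] by auto
  qed
  have ind: "independent (w ` ?T)"
  proof (rule pairwise_orthogonal_independent)
    show "pairwise orthogonal (w ` ?T)"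
      by (auto simp: pairwise_image pairwise_def orthogonal_def intro!: orth)
    show "0 \<notin> w ` ?T" using nz by force
  qed
  have sub: "w ` ?T \<subseteq> radial x" using wR by auto
  \<comment> \<open>The orthogonal complement of these vectors inside the radial vectors is invariant; were it
    nonzero, it would contain an eigenvector, which is a multiple of one of them.\<close>
  have span: "radial x \<subseteq> span (w ` ?T)"
  proof
    fix v assume v: "v \<in> radial x"
    define S where "S = radial x \<inter> {y. \<forall>b\<in>w ` ?T. orthogonal b y}"
    have S: "subspace S"
      unfolding S_def by (intro subspace_inter subspace_radial subspace_orthogonal_to_vectors)
    have inv: "A *v y \<in> S" if "y \<in> S" for y
      using that wev by (auto simp: S_def A_radial orthogonal_def A_selfadjoint[symmetric])
    obtain y z where y: "y \<in> span (w ` ?T)" and z: "\<And>b. b \<in> span (w ` ?T) \<Longrightarrow> orthogonal z b"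
      and vyz: "v = y + z" using orthogonal_subspace_decomp_exists[of "w ` ?T" v] by metis
    have "span (w ` ?T) \<subseteq> radial x" using sub subspace_radial by (rule span_minimal)
    then have "z \<in> radial x"
      using y v vyz subspace_diff[OF subspace_radial, of v x y] by auto
    moreover have "orthogonal b z" if "b \<in> w ` ?T" for b
      using z[OF span_base[OF that]] by (simp add: orthogonal_commute)
    ultimately have zS: "z \<in> S" by (simp add: S_def)
    have "z = 0"
    proof (rule ccontr)
      assume "z \<noteq> 0"
      obtain e l where e: "e \<in> S" "e \<noteq> 0" "A *v e = l *\<^sub>R e"
        using selfadjoint_max_eigenvector[OF A_linear A_selfadjoint S inv zS \<open>z \<noteq> 0\<close>] by metis
      then have l: "l \<in> ?T" by (auto simp: eigenvalue_iff)
      have eR: "e \<in> radial x" using e(1) by (simp add: S_def)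
      define q where "q = e - e $ x *\<^sub>R w l"
      have "q \<in> radial x"
        unfolding q_def by (intro subspace_diff subspace_scale subspace_radial eR wR l)
      moreover have "A *v q = l *\<^sub>R q"
        by (simp add: q_def linear_diff[OF A_linear] linear_scale[OF A_linear] e wev[OF l] algebra_simps)
      moreover have "q $ x = 0" by (simp add: q_def w1[OF l])
      ultimately have "q = 0" by (rule radial_eigenvector_zero)
      then have "e = e $ x *\<^sub>R w l" by (simp add: q_def)
      moreover have "w l \<bullet> e = 0" using e(1) l by (auto simp: S_def orthogonal_def)
      ultimately have "e \<bullet> e = 0" by (metis inner_scaleR_left mult_zero_right)
      then show False using e(2) by simp
    qed
    then show "v \<in> span (w ` ?T)" using y vyz by simp
  qed
  have "card (w ` ?T) = dim (radial x)" by (rule basis_card_eq_dim[OF sub span ind])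
  then show ?thesis using inj by (simp add: card_image dim_radial)
qed

abbreviation \<theta> where "\<theta> \<equiv> graph_eigenvalue E"

lemma eigenvalue_in: "i \<le> d \<Longrightarrow> \<theta> i \<in> graph_eigenvalues E"
  using nth_mem[of i "rev (sorted_list_of_set (graph_eigenvalues E))"]
  by (simp add: graph_eigenvalue_def card_eigenvalues finite_eigenvalues)

lemma eigenvalue_index:
  assumes "t \<in> graph_eigenvalues E"
  obtains i where "i \<le> d" "t = \<theta> i"
proof -
  have "t \<in> set (rev (sorted_list_of_set (graph_eigenvalues E)))"
    using assms by (simp add: finite_eigenvalues)
  then obtain i where "i < length (rev (sorted_list_of_set (graph_eigenvalues E)))"
    "rev (sorted_list_of_set (graph_eigenvalues E)) ! i = t" by (metis in_set_conv_nth)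
  then show thesis using that[of i] by (simp add: graph_eigenvalue_def card_eigenvalues)
qed

lemma eigenvalue_strict_decreasing:
  assumes "i < j" "j \<le> d"
  shows "\<theta> j < \<theta> i"
proof -
  have "sorted_wrt (>) (rev (sorted_list_of_set (graph_eigenvalues E)))"
    by (simp add: sorted_wrt_rev)
  from sorted_wrt_nth_less[OF this assms(1)] show ?thesis
    using assms(2) by (simp add: graph_eigenvalue_def card_eigenvalues)
qed

section \<open>Location of the eigenvalues\<close>

lemma degree:
  assumes "0 < d"
  shows "card {z. E x z} = valency E"
proof -
  have "card (graph_sphere E 1 x \<inter> graph_sphere E 1 x) = p 0 1 1"
    using intersection_number_eq[OF dr, of 1 1 x x] assms by simp
  moreover have "graph_sphere E 1 x = {z. E x z}"
    by (auto simp: graph_sphere_def dist_1)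
  ultimately show ?thesis using assms by (simp add: valency_def isect_b_def)
qed

text \<open>
  For \<open>c = 1\<close> and \<open>c = - 1\<close> the right-hand side comes from the forms \<open>k I + A\<close> and \<open>k I - A\<close>.
  Writing them as sums of squares over the edges gives \<open>- k \<le> t \<le> k\<close> for every
  eigenvalue \<open>t\<close>, together with the cases of equality.
\<close>

lemma edge_form:
  assumes "0 < d" and c: "c * c = 1"
  shows "(\<Sum>x\<in>UNIV. \<Sum>z | E x z. (v $ x + c * v $ z)\<^sup>2) =
    2 * (real (valency E) * (v \<bullet> v) + c * (v \<bullet> (A *v v)))"
proof -
  have 1: "(\<Sum>x\<in>UNIV. \<Sum>z | E x z. (v $ x)\<^sup>2) = real (valency E) * (v \<bullet> v)"
    by (simp add: degree[OF assms(1)] inner_vec_def sum_distrib_left power2_eq_square)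
  have "(\<Sum>x\<in>UNIV. \<Sum>z | E x z. (v $ z)\<^sup>2) = (\<Sum>x\<in>UNIV. \<Sum>z\<in>UNIV. if E x z then (v $ z)\<^sup>2 else 0)"
    by (simp add: sum.If_cases)
  also have "\<dots> = (\<Sum>z\<in>UNIV. \<Sum>x\<in>UNIV. if E x z then (v $ z)\<^sup>2 else 0)" by (rule sum.swap)
  also have "\<dots> = (\<Sum>z\<in>UNIV. \<Sum>x | E z x. (v $ z)\<^sup>2)"
    by (simp add: sum.If_cases adj_sym)
  finally have 2: "(\<Sum>x\<in>UNIV. \<Sum>z | E x z. (v $ z)\<^sup>2) = real (valency E) * (v \<bullet> v)"
    using 1 by simp
  have 3: "(\<Sum>x\<in>UNIV. \<Sum>z | E x z. v $ x * v $ z) = v \<bullet> (A *v v)"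
    by (simp add: inner_vec_def A_apply sum_distrib_left)
  have "(\<Sum>x\<in>UNIV. \<Sum>z | E x z. (v $ x + c * v $ z)\<^sup>2) =
    (\<Sum>x\<in>UNIV. \<Sum>z | E x z. (v $ x)\<^sup>2 + (v $ z)\<^sup>2 + 2 * c * (v $ x * v $ z))"
  proof (intro sum.cong refl)
    fix x z
    have "(v $ x + c * v $ z)\<^sup>2 = (v $ x)\<^sup>2 + (c * c) * (v $ z)\<^sup>2 + 2 * c * (v $ x * v $ z)"
      by (simp add: power2_eq_square algebra_simps)
    then show "(v $ x + c * v $ z)\<^sup>2 = (v $ x)\<^sup>2 + (v $ z)\<^sup>2 + 2 * c * (v $ x * v $ z)"
      by (simp add: c)
  qed
  also have "\<dots> = 2 * (real (valency E) * (v \<bullet> v)) + 2 * c * (v \<bullet> (A *v v))"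
    by (simp only: sum.distrib 1 2 3[symmetric] flip: sum_distrib_left)
  finally show ?thesis by simp
qed

lemma eigenvalue_le_valency:
  assumes "0 < d" "t \<in> graph_eigenvalues E"
  shows "t \<le> real (valency E)" "- real (valency E) \<le> t"
proof -
  let ?k = "real (valency E)"
  obtain v where v: "v \<noteq> 0" "A *v v = t *\<^sub>R v" using assms(2) by (auto simp: eigenvalue_iff)
  have "0 \<le> ?k + c * t" if c: "c * c = 1" for c
  proof -
    have "0 \<le> (\<Sum>x\<in>UNIV. \<Sum>z | E x z. (v $ x + c * v $ z)\<^sup>2)" by (intro sum_nonneg) simp
    also have "\<dots> = 2 * ((?k + c * t) * (v \<bullet> v))"
      unfolding edge_form[OF assms(1) c] v(2) by (simp add: algebra_simps)
    finally have "0 \<le> (?k + c * t) * (v \<bullet> v)" by (simp add: mult.commute)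
    moreover have "0 < v \<bullet> v" using v(1) by simp
    ultimately show ?thesis using zero_le_mult_iff[of "?k + c * t" "v \<bullet> v"] by linarith
  qed
  from this[of 1] this[of "-1"] show "t \<le> ?k" "- ?k \<le> t" by simp_all
qed

lemma extremal_eigenvector_edge:
  assumes "0 < d" and c: "c * c = 1" and ev: "A *v v = (- c * real (valency E)) *\<^sub>R v" and "E x z"
  shows "v $ x = - c * v $ z"
proof -
  have "(\<Sum>x\<in>UNIV. \<Sum>z | E x z. (v $ x + c * v $ z)\<^sup>2) = 0"
    unfolding edge_form[OF assms(1) c] ev using c by (simp flip: mult.assoc)
  then have "(\<Sum>z | E x z. (v $ x + c * v $ z)\<^sup>2) = 0"
    by (subst (asm) sum_nonneg_eq_0_iff) (auto intro: sum_nonneg)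
  then have "(v $ x + c * v $ z)\<^sup>2 = 0"
    using \<open>E x z\<close> by (subst (asm) sum_nonneg_eq_0_iff) auto
  then show ?thesis by simp
qed

lemma connected_propagate:
  assumes "P x" and "\<And>y z. E y z \<Longrightarrow> P y \<Longrightarrow> P z"
  shows "P y"
proof -
  have "E\<^sup>*\<^sup>* x y" using conn by (simp add: connected_graph_def)
  then show ?thesis by (induction rule: rtranclp_induct) (use assms in auto)
qed

lemma valency_eigenvector_constant:
  assumes "0 < d" "A *v v = real (valency E) *\<^sub>R v"
  shows "v $ y = v $ x"
proof (rule connected_propagate[of "\<lambda>y. v $ y = v $ x"])
  fix y z assume "E y z" "v $ y = v $ x"
  then show "v $ z = v $ x" using extremal_eigenvector_edge[of "-1" v y z] assms by simp
qed simp

text \<open>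
  An eigenvector for \<open>- k\<close> changes sign along every edge, and by connectedness it vanishes nowhere;
  so its sign is a proper two-colouring.
\<close>

lemma bipartite_if_minus_valency:
  assumes "0 < d" "- real (valency E) \<in> graph_eigenvalues E"
  shows "bipartite_graph E"
proof -
  obtain v where v: "v \<noteq> 0" "A *v v = - real (valency E) *\<^sub>R v" using assms(2) by (auto simp: eigenvalue_iff)
  have opp: "v $ x = - v $ z" if "E x z" for x z
    using extremal_eigenvector_edge[of 1 v x z] assms(1) v(2) that by simp
  obtain x where "v $ x \<noteq> 0" using v(1) by (auto simp: vec_eq_iff)
  then have nz: "v $ y \<noteq> 0" for y
    by (rule connected_propagate[of "\<lambda>y. v $ y \<noteq> 0"]) (use opp in force)
  have "x \<in> {x. v $ x > 0} \<longleftrightarrow> z \<notin> {x. v $ x > 0}" if "E x z" for x z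
    using opp[OF that] nz[of z] by auto
  then show ?thesis unfolding bipartite_graph_def by blast
qed

lemma A_one: "0 < d \<Longrightarrow> A *v 1 = real (valency E) *\<^sub>R 1"
  by (simp add: vec_eq_iff A_apply degree)

lemma theta_0:
  assumes "0 < d"
  shows "\<theta> 0 = real (valency E)"
proof -
  have "real (valency E) \<in> graph_eigenvalues E"
    unfolding eigenvalue_iff using A_one[OF assms] by (intro exI[of _ 1]) (simp add: vec_eq_iff)
  then obtain i where i: "i \<le> d" "real (valency E) = \<theta> i" by (rule eigenvalue_index)
  then have "\<theta> 0 \<le> \<theta> i" using eigenvalue_le_valency(1)[OF assms eigenvalue_in[of 0]] by simp
  then have "\<theta> 0 \<le> \<theta> i \<and> \<theta> i \<le> \<theta> 0"
    using eigenvalue_strict_decreasing[of 0 i] i(1) by (cases "i = 0") auto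
  then show ?thesis using i(2) by simp
qed

lemma A_axis: "(A *v axis x 1) $ y = (if E y x then 1 else 0)"
  by (simp add: A_apply axis_def)

text \<open>
  On the orthogonal complement of the constant vectors, the test vector \<open>e\<^sub>x - e\<^sub>y\<close> for distinct
  nonadjacent \<open>x\<close> and \<open>y\<close> has Rayleigh quotient \<open>0\<close>. So that complement contains an eigenvector with
  nonnegative eigenvalue, and this eigenvalue is not \<open>k\<close>, whose eigenvectors are constant.
\<close>

lemma theta_1_nonneg:
  assumes "2 \<le> d"
  shows "0 \<le> \<theta> 1"
proof -
  have d0: "0 < d" using assms by simp
  fix x :: 'v
  obtain y where y: "\<partial> x y = 2" using sphere_nonempty[OF assms] by blast
  have xy: "x \<noteq> y" "\<not> E x y" "\<not> E y x" using y dist_0[of x y] dist_1[of x y] adj_sym[of x y] by auto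
  let ?S = "{v. orthogonal (1::real^'v) v}"
  define w :: "real^'v" where "w = axis x 1 - axis y 1"
  have S: "subspace ?S" by (rule subspace_orthogonal_to_vector)
  have inv: "A *v v \<in> ?S" if "v \<in> ?S" for v
    using that A_one[OF d0] by (simp add: orthogonal_def A_selfadjoint[symmetric])
  have wS: "w \<in> ?S" by (simp add: orthogonal_def w_def inner_diff_right inner_axis)
  have ww: "w \<bullet> w = 2" using xy by (simp add: w_def inner_diff inner_axis_axis)
  have wAw: "w \<bullet> (A *v w) = 0"
    using xy adj_irrefl
    by (simp add: w_def linear_diff[OF A_linear] inner_diff inner_axis' A_axis)
  have w0: "w \<noteq> 0" using ww by auto
  obtain v l where v: "v \<in> ?S" "v \<noteq> 0" "A *v v = l *\<^sub>R v" and l: "w \<bullet> (A *v w) \<le> l * (w \<bullet> w)"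
    using selfadjoint_max_eigenvector[OF A_linear A_selfadjoint S inv wS w0] wS by metis
  have "0 \<le> l" using l by (simp add: ww wAw)
  have "l \<noteq> real (valency E)"
  proof
    assume "l = real (valency E)"
    then have const: "v $ y = v $ x" for y using valency_eigenvector_constant[OF d0] v(3) by simp
    have "(1::real^'v) \<bullet> v = (\<Sum>y\<in>UNIV. v $ y)" by (simp add: inner_vec_def)
    also have "\<dots> = (\<Sum>y\<in>(UNIV :: 'v set). v $ x)" by (intro sum.cong refl const)
    finally have "v $ x = 0" using v(1) by (simp add: orthogonal_def)
    then have "v $ y = 0" for y using const[of y] by simp
    then show False using v(2) by (simp add: vec_eq_iff)
  qed
  moreover obtain i where i: "i \<le> d" "l = \<theta> i"
    using eigenvalue_index[of l] v by (auto simp: eigenvalue_iff)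
  ultimately have "i \<noteq> 0" using theta_0[OF d0] by (cases "i = 0") auto
  then have "\<theta> i \<le> \<theta> 1" using eigenvalue_strict_decreasing[of 1 i] i(1) by (cases "i = 1") auto
  then show ?thesis using i(2) \<open>0 \<le> l\<close> by simp
qed

text \<open>
  Let \<open>x, y, z\<close> be an induced path. The test vector \<open>e\<^sub>x - e\<^sub>y + e\<^sub>z\<close> has Rayleigh quotient \<open>- 4 / 3\<close>.
\<close>

lemma theta_d_less:
  assumes "2 \<le> d"
  shows "\<theta> d < - 1"
proof -
  fix x :: 'v
  obtain z where z: "\<partial> x z = 2" using sphere_nonempty[OF assms] by blast
  then obtain y where y: "\<partial> x y = 1" "E y z" using dist_pred[of x z 1] by (metis Suc_1)
  have adj: "E x y" "E y x" "E y z" "E z y" "\<not> E x z" "\<not> E z x" "x \<noteq> y" "y \<noteq> z" "x \<noteq> z"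
    using y z dist_1[of x y] dist_1[of x z] adj_sym dist_0[of x z] adj_irrefl by auto
  define w :: "real^'v" where "w = axis x 1 - axis y 1 + axis z 1"
  have ww: "w \<bullet> w = 3" using adj by (simp add: w_def inner_diff inner_add inner_axis_axis)
  have wAw: "w \<bullet> (A *v w) = - 4"
    using adj adj_irrefl
    by (simp add: w_def linear_diff[OF A_linear] linear_add[OF A_linear] inner_diff inner_add inner_axis' A_axis)
  have w0: "w \<noteq> 0" using ww by auto
  have lin: "linear (\<lambda>v. - (A *v v))" using A_linear by (rule linear_compose_neg)
  have sa: "- (A *v v) \<bullet> w = v \<bullet> - (A *v w)" for v w by (simp add: A_selfadjoint)
  obtain v l where v: "v \<noteq> 0" "- (A *v v) = l *\<^sub>R v" and l: "w \<bullet> - (A *v w) \<le> l * (w \<bullet> w)"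
    using selfadjoint_max_eigenvector[OF lin sa subspace_UNIV UNIV_I UNIV_I w0] by (metis UNIV_I)
  have "A *v v = (- l) *\<^sub>R v" using v(2) by (metis minus_minus scaleR_minus_left)
  then have "- l \<in> graph_eigenvalues E" using v(1) by (auto simp: eigenvalue_iff)
  then obtain i where i: "i \<le> d" "- l = \<theta> i" by (rule eigenvalue_index)
  have "\<theta> d \<le> \<theta> i" using eigenvalue_strict_decreasing[of i d] i(1) by (cases "i = d") auto
  then show ?thesis using l i(2) by (simp add: ww wAw)
qed

section \<open>The common neighbours of an edge\<close>

lemma common_neighbours:
  assumes "E x y"
  shows "card {z. E x z \<and> E y z} = isect_a E 1"
proof -
  have 1: "\<partial> x y = 1" using assms dist_1 by simp
  then have "1 \<le> d" using graph_dist_le_diameter[of E x y] by simp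
  then have "card (graph_sphere E 1 x \<inter> graph_sphere E 1 y) = isect_a E 1"
    using intersection_number_eq[OF dr, of 1 1 x y] 1 by (simp add: isect_a_def)
  moreover have "graph_sphere E 1 x \<inter> graph_sphere E 1 y = {z. E x z \<and> E y z}"
    by (auto simp: graph_sphere_def dist_1)
  ultimately show ?thesis by simp
qed

lemma distant_neighbours:
  assumes "2 \<le> d" "E x y"
  shows "card {z. E x z \<and> \<partial> y z = 2} = isect_b E 1"
proof -
  have "\<partial> x y = 1" using assms dist_1 by simp
  then have "card (graph_sphere E 1 x \<inter> graph_sphere E 2 y) = isect_b E 1"
    using intersection_number_eq[OF dr, of 1 2 x y] assms(1) by (simp add: isect_b_def numeral_2_eq_2)
  moreover have "graph_sphere E 1 x \<inter> graph_sphere E 2 y = {z. E x z \<and> \<partial> y z = 2}"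
    by (auto simp: graph_sphere_def dist_1)
  ultimately show ?thesis by simp
qed

lemma dist_neighbours:
  assumes "E x y" "E x z"
  shows "y = z \<or> E y z \<or> \<partial> y z = 2"
proof -
  have "\<partial> y z \<le> 2" using dist_step[OF assms(2), of y] assms(1) dist_1[of x y] dist_sym[of x y] by simp
  moreover have "\<partial> y z \<noteq> 0 \<or> y = z" "\<partial> y z \<noteq> 1 \<or> E y z" using dist_0 dist_1 by auto
  ultimately show ?thesis by linarith
qed

text \<open>
  Seen from \<open>y\<close>, the neighbours of \<open>x\<close> are \<open>y\<close> itself, the \<open>a\<^sub>1\<close> common neighbours, and \<open>b\<^sub>1\<close> vertices
  at distance \<open>2\<close>.
\<close>

lemma nbr_sum_split:
  fixes g :: "nat \<Rightarrow> real"
  assumes "2 \<le> d" "E x y"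
  shows "(\<Sum>z | E x z. g (\<partial> y z)) = g 0 + real (isect_a E 1) * g 1 + real (isect_b E 1) * g 2"
proof -
  let ?W = "{z. E x z \<and> E y z}" and ?B = "{z. E x z \<and> \<partial> y z = 2}"
  have eq: "{z. E x z} = insert y (?W \<union> ?B)" using assms(2) dist_neighbours by auto
  have disj: "y \<notin> ?W \<union> ?B" "?W \<inter> ?B = {}"
    by (simp add: adj_irrefl) (auto simp flip: dist_1)
  have "(\<Sum>z | E x z. g (\<partial> y z)) = g 0 + ((\<Sum>z\<in>?W. g (\<partial> y z)) + (\<Sum>z\<in>?B. g (\<partial> y z)))"
    unfolding eq using disj by (simp add: sum.union_disjoint del: Un_iff)
  also have "(\<Sum>z\<in>?W. g (\<partial> y z)) = (\<Sum>z\<in>?W. g 1)"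
    by (intro sum.cong refl) (auto simp flip: dist_1)
  finally show ?thesis
    by (simp add: common_neighbours[OF assms(2)] distant_neighbours[OF assms])
qed

lemma valency_eq:
  assumes "2 \<le> d"
  shows "real (valency E) = 1 + real (isect_a E 1) + real (isect_b E 1)"
proof -
  obtain x y where "\<partial> x y = 1" using graph_dist_attained[OF conn, of 1] assms by auto
  then have "E x y" using dist_1 by simp
  from nbr_sum_split[OF assms this, of "\<lambda>_. 1"] show ?thesis using assms by (simp add: degree)
qed

lemma b1_pos:
  assumes "2 \<le> d"
  shows "0 < isect_b E 1"
proof -
  obtain y z where yz: "\<partial> y z = 2" using graph_dist_attained[OF conn assms] by blast
  then obtain x where x: "\<partial> y x = 1" "E x z" using dist_pred[of y z 1] by (metis Suc_1)
  then have xy: "E x y" using dist_1[of y x] adj_sym by simp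
  have "z \<in> {z. E x z \<and> \<partial> y z = 2}" using x yz by simp
  then have "card {z. E x z \<and> \<partial> y z = 2} \<noteq> 0" by (auto simp: card_eq_0_iff)
  then show ?thesis using distant_neighbours[OF assms xy] by simp
qed

text \<open>
  This counts the ordered pairs in \<open>W\<close> at distance \<open>2\<close>. If the vertices of \<open>W\<close> have a common
  neighbour, these are the pairs of distinct nonadjacent vertices. The value is a real number because
  it is only used in inequalities between reals.
\<close>

definition nonadjacent_pairs :: "'v set \<Rightarrow> real" where
  "nonadjacent_pairs W = (\<Sum>z\<in>W. \<Sum>w\<in>W. if \<partial> z w = 2 then 1 else 0)"

text \<open>
  With \<open>r\<close> the Gram representation for \<open>t\<close>, the vectors \<open>r x\<close>, \<open>r y\<close> and the sum \<open>R\<close> of the \<open>r z\<close> over the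
  common neighbours \<open>z\<close> of \<open>x\<close> and \<open>y\<close> have inner products that involve only the cosines at
  distances \<open>0\<close>, \<open>1\<close>, \<open>2\<close>, which are \<open>1\<close>, \<open>s\<close> and \<open>s'\<close>. The inequality says that the component
  of \<open>R\<close> orthogonal to \<open>r x\<close> and \<open>r y\<close> has nonnegative squared length.
\<close>

lemma gram_inequality:
  assumes d: "2 \<le> d" and t: "t \<in> graph_eigenvalues E" "- real (valency E) < t" and xy: "E x y"
  defines "a \<equiv> real (isect_a E 1)" and "n \<equiv> nonadjacent_pairs {z. E x z \<and> E y z}"
    and "s \<equiv> t / real (valency E)"
  shows "\<exists>s'. real (isect_b E 1) * s' = t * s - 1 - a * s \<and>
    0 \<le> a\<^sup>2 * s + a * (1 - s) + n * (s' - s) - 2 * a\<^sup>2 * s\<^sup>2 / (1 + s)"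
proof -
  let ?k = "real (valency E)" and ?W = "{z. E x z \<and> E y z}"
  have k: "?k > 0" using valency_eq[OF d] by simp
  obtain u :: "nat \<Rightarrow> real" where u0: "u 0 = 1"
    and u: "\<And>a b. (\<Sum>z | E b z. u (\<partial> a z)) = t * u (\<partial> a b)"
    using cosine_sequence_exists[OF t(1)] by blast
  obtain r :: "'v \<Rightarrow> real^'v" and \<gamma> where \<gamma>: "\<gamma> > 0" and r: "\<And>a b. r a \<bullet> r b = \<gamma> * u (\<partial> a b)"
    by (rule cosine_gram_representation[OF u0 u], rule that)
  have "(\<Sum>z | E x z. u (\<partial> x z)) = (\<Sum>z | E x z. u 1)" by (intro sum.cong refl) (auto simp flip: dist_1)
  then have "?k * u 1 = t" using u[of x x] d by (simp add: u0 degree)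
  then have u1: "u 1 = s" using k by (simp add: s_def field_simps)
  have "u 0 + a * u 1 + real (isect_b E 1) * u 2 = t * u 1"
    using nbr_sum_split[OF d xy, of u] u[of y x] xy dist_1[of y x] adj_sym[of x y] by (simp add: a_def)
  then have u2: "real (isect_b E 1) * u 2 = t * s - 1 - a * s" unfolding u0 u1 by simp
  have s1: "1 + s > 0" using t(2) k by (simp add: s_def field_simps)
  have cardW: "real (card ?W) = a" by (simp add: a_def common_neighbours[OF xy])
  have WW: "(\<Sum>z\<in>?W. \<Sum>w\<in>?W. u (\<partial> z w)) = a\<^sup>2 * s + a * (1 - s) + n * (u 2 - s)"
  proof -
    have "u (\<partial> z w) = s + (if z = w then 1 - s else 0) + (u 2 - s) * (if \<partial> z w = 2 then 1 else 0)"
      if "z \<in> ?W" "w \<in> ?W" for z w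
      using dist_neighbours[of x z w] that dist_1[of z w] by (auto simp: u0 u1[symmetric])
    then have "(\<Sum>z\<in>?W. \<Sum>w\<in>?W. u (\<partial> z w)) = (\<Sum>z\<in>?W. \<Sum>w\<in>?W.
        s + (if z = w then 1 - s else 0) + (u 2 - s) * (if \<partial> z w = 2 then 1 else 0))"
      by (intro sum.cong refl) blast
    also have "\<dots> = real (card ?W) * (real (card ?W) * s) + real (card ?W) * (1 - s) + (u 2 - s) * n"
      by (simp add: sum.distrib n_def nonadjacent_pairs_def sum_distrib_left[symmetric] distrib_left
          del: mem_Collect_eq)
    finally show ?thesis unfolding cardW by (simp add: power2_eq_square algebra_simps)
  qed
  define R where "R = (\<Sum>z\<in>?W. r z)"
  have RR: "R \<bullet> R = \<gamma> * (a\<^sup>2 * s + a * (1 - s) + n * (u 2 - s))"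
    unfolding WW[symmetric] R_def inner_sum_left inner_sum_right r sum_distrib_left by (rule sum.swap)
  have xR: "r x \<bullet> R = \<gamma> * (a * s)" "r y \<bullet> R = \<gamma> * (a * s)"
  proof -
    have "(\<Sum>z\<in>?W. u (\<partial> x z)) = (\<Sum>z\<in>?W. s)" "(\<Sum>z\<in>?W. u (\<partial> y z)) = (\<Sum>z\<in>?W. s)"
      by (auto intro!: sum.cong simp: u1[symmetric] simp flip: dist_1)
    then show "r x \<bullet> R = \<gamma> * (a * s)" "r y \<bullet> R = \<gamma> * (a * s)"
      by (simp_all add: R_def inner_sum_right r cardW flip: sum_distrib_left)
  qed
  have xx: "r x \<bullet> r x = \<gamma>" "r y \<bullet> r y = \<gamma>" "r x \<bullet> r y = \<gamma> * s"
    using xy dist_1[of x y] by (simp_all add: r u0 u1[symmetric])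
  \<comment> \<open>By symmetry in \<open>x\<close> and \<open>y\<close>, the projection of \<open>R\<close> onto their span is \<open>c (r x + r y)\<close>.\<close>
  define c where "c = a * s / (1 + s)"
  have "0 \<le> (R - c *\<^sub>R (r x + r y)) \<bullet> (R - c *\<^sub>R (r x + r y))" by simp
  also have "\<dots> = R \<bullet> R - 2 * c * (r x \<bullet> R + r y \<bullet> R)
      + c\<^sup>2 * (r x \<bullet> r x + 2 * (r x \<bullet> r y) + r y \<bullet> r y)"
    by (simp add: inner_simps inner_commute power2_eq_square algebra_simps)
  also have "\<dots> = \<gamma> * (a\<^sup>2 * s + a * (1 - s) + n * (u 2 - s) - 4 * c * (a * s) + 2 * c * (c * (1 + s)))"
    unfolding RR xR xx by (simp add: power2_eq_square algebra_simps)
  also have "c * (1 + s) = a * s" using s1 by (simp add: c_def)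
  finally have "0 \<le> a\<^sup>2 * s + a * (1 - s) + n * (u 2 - s) - 4 * c * (a * s) + 2 * c * (a * s)"
    using \<gamma> by (simp only: zero_le_mult_iff) auto
  then have "0 \<le> a\<^sup>2 * s + a * (1 - s) + n * (u 2 - s) - 2 * c * (a * s)" by (simp add: algebra_simps)
  moreover have "2 * c * (a * s) = 2 * a\<^sup>2 * s\<^sup>2 / (1 + s)" by (simp add: c_def power2_eq_square)
  ultimately show ?thesis using u2 by auto
qed

text \<open>
  Multiplying the Gram inequality by \<open>b k (1 + s)\<close> eliminates \<open>s'\<close> and leaves a multiple of \<open>1 - s\<close>.
  Both \<open>1 + s\<close> and \<open>1 - s\<close> are positive since \<open>t\<close> lies strictly between \<open>- k\<close> and \<open>k\<close>. The number \<open>n\<close> depends on the edge but not on \<open>t\<close>.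
\<close>

lemma edge_inequality:
  assumes d: "2 \<le> d" and t: "t \<in> graph_eigenvalues E" "- real (valency E) < t" "t < real (valency E)"
    and xy: "E x y"
  defines "k \<equiv> real (valency E)" and "a \<equiv> real (isect_a E 1)" and "b \<equiv> real (isect_b E 1)"
    and "n \<equiv> nonadjacent_pairs {z. E x z \<and> E y z}"
  shows "n * ((k + t) * (1 + t)) \<le> a * b * (k + t * (a + 1))"
proof -
  have k: "k > 0" "b = k - 1 - a" "k \<noteq> 0" using valency_eq[OF d] by (auto simp: k_def a_def b_def)
  define s where "s = t / k"
  obtain s' where s': "b * s' = t * s - 1 - a * s"
    and ineq: "0 \<le> a\<^sup>2 * s + a * (1 - s) + n * (s' - s) - 2 * a\<^sup>2 * s\<^sup>2 / (1 + s)"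
    using gram_inequality[OF d t(1,2) xy] unfolding k_def a_def b_def n_def s_def by blast
  have ts: "t = k * s" using k by (simp add: s_def)
  have s1: "1 + s > 0" "1 - s > 0" using t k by (auto simp: s_def k_def field_simps)
  have "b \<ge> 0" by (simp add: b_def)
  have "b * (s' - s) = (t * s - 1 - a * s) - (k - 1 - a) * s"
    unfolding right_diff_distrib s' by (simp only: k(2))
  also have "\<dots> = - (1 - s) * (1 + t)" by (simp add: ts algebra_simps)
  finally have bs: "b * (s' - s) = - (1 - s) * (1 + t)" .
  have "0 \<le> (a\<^sup>2 * s + a * (1 - s) + n * (s' - s) - 2 * a\<^sup>2 * s\<^sup>2 / (1 + s)) * (1 + s)"
    using ineq s1(1) by (intro mult_nonneg_nonneg) auto
  also have "\<dots> = (a\<^sup>2 * s + a * (1 - s) + n * (s' - s)) * (1 + s) - 2 * a\<^sup>2 * s\<^sup>2"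
    using s1(1) by (simp add: left_diff_distrib)
  finally have "0 \<le> b * ((a\<^sup>2 * s + a * (1 - s) + n * (s' - s)) * (1 + s) - 2 * a\<^sup>2 * s\<^sup>2)"
    using \<open>b \<ge> 0\<close> by simp
  also have "\<dots> = b * ((a\<^sup>2 * s + a * (1 - s)) * (1 + s) - 2 * a\<^sup>2 * s\<^sup>2) + n * (b * (s' - s)) * (1 + s)"
    by (simp add: algebra_simps)
  also have "\<dots> = (1 - s) * (a * b * (1 + s * (a + 1)) - n * ((1 + s) * (1 + t)))"
    unfolding bs by (simp add: power2_eq_square algebra_simps)
  finally have "0 \<le> a * b * (1 + s * (a + 1)) - n * ((1 + s) * (1 + t))"
    using s1(2) by (simp add: zero_le_mult_iff)
  then have "0 \<le> k * (a * b * (1 + s * (a + 1)) - n * ((1 + s) * (1 + t)))"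
    using k(1) by simp
  also have "\<dots> = a * b * (k + (k * s) * (a + 1)) - n * ((k + k * s) * (1 + t))"
    by (simp add: algebra_simps)
  finally show ?thesis by (simp flip: ts)
qed

text \<open>
  For \<open>a > 0\<close>, divide the edge inequality by \<open>a b (k + t) (1 + t)\<close>, which is positive for \<open>t = \<theta> 1\<close> and
  negative for \<open>t = \<theta> d\<close>. The quotient \<open>n / (a b)\<close> of one and the same edge then lies between both sides.
  For \<open>a = 0\<close> the number \<open>0\<close> does.
\<close>

lemma theta_quotient_inequality:
  assumes d: "2 \<le> d" and nb: "\<not> bipartite_graph E"
  defines "k \<equiv> real (valency E)" and "a \<equiv> real (isect_a E 1)"
  shows "(k + \<theta> d * (a + 1)) / ((k + \<theta> d) * (1 + \<theta> d)) \<le> (k + \<theta> 1 * (a + 1)) / ((k + \<theta> 1) * (1 + \<theta> 1))"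
    and "- k < \<theta> d"
proof -
  define b where "b = real (isect_b E 1)"
  have d0: "0 < d" using d by simp
  have k: "k = 1 + a + b" "a \<ge> 0" "b > 0"
    using valency_eq[OF d] b1_pos[OF d] by (auto simp: k_def a_def b_def)
  have 1: "\<theta> 1 \<in> graph_eigenvalues E" "0 \<le> \<theta> 1" "\<theta> 1 < k"
    using eigenvalue_in[of 1] theta_1_nonneg[OF d] eigenvalue_strict_decreasing[of 0 1] theta_0[OF d0] d
    by (auto simp: k_def)
  have D: "\<theta> d \<in> graph_eigenvalues E" "\<theta> d < - 1" using eigenvalue_in[of d] theta_d_less[OF d] by auto
  have "\<theta> d \<noteq> - k" using bipartite_if_minus_valency[OF d0] nb D(1) by (auto simp: k_def)
  then show Dk: "- k < \<theta> d" using eigenvalue_le_valency(2)[OF d0 D(1)] by (simp add: k_def)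
  have p1: "(k + \<theta> 1) * (1 + \<theta> 1) > 0" using 1 k by (intro mult_pos_pos) auto
  have pD: "(k + \<theta> d) * (1 + \<theta> d) < 0" using D Dk by (intro mult_pos_neg) auto
  show "(k + \<theta> d * (a + 1)) / ((k + \<theta> d) * (1 + \<theta> d)) \<le> (k + \<theta> 1 * (a + 1)) / ((k + \<theta> 1) * (1 + \<theta> 1))"
  proof (cases "a = 0")
    case True
    have "(k + \<theta> d) / ((k + \<theta> d) * (1 + \<theta> d)) \<le> 0"
      using pD Dk by (intro divide_nonneg_neg) auto
    also have "0 \<le> (k + \<theta> 1) / ((k + \<theta> 1) * (1 + \<theta> 1))"
      using p1 1 k by (intro divide_nonneg_pos) auto
    finally show ?thesis by (simp add: True)
  next
    case False
    obtain x y where "\<partial> x y = 1" using graph_dist_attained[OF conn, of 1] d by auto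
    then have xy: "E x y" using dist_1 by simp
    define n where "n = nonadjacent_pairs {z. E x z \<and> E y z}"
    define q where "q = n / (a * b)"
    have ab: "a * b > 0" using k False by simp
    have ineq: "q * ((k + t) * (1 + t)) \<le> k + t * (a + 1)"
      if "t \<in> graph_eigenvalues E" "- k < t" "t < k" for t
    proof -
      have "n * ((k + t) * (1 + t)) \<le> a * b * (k + t * (a + 1))"
        using edge_inequality[OF d that(1) _ _ xy] that(2,3) by (simp add: k_def a_def b_def n_def)
      then show ?thesis using ab by (simp add: q_def field_simps)
    qed
    have "q * ((k + \<theta> d) * (1 + \<theta> d)) \<le> k + \<theta> d * (a + 1)"
      using ineq[OF D(1) Dk] D(2) k by simp
    then have "(k + \<theta> d * (a + 1)) / ((k + \<theta> d) * (1 + \<theta> d)) \<le> q"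
      using pD by (simp add: neg_divide_le_eq)
    also have "q * ((k + \<theta> 1) * (1 + \<theta> 1)) \<le> k + \<theta> 1 * (a + 1)"
      using ineq[OF 1(1)] 1 k by simp
    then have "q \<le> (k + \<theta> 1 * (a + 1)) / ((k + \<theta> 1) * (1 + \<theta> 1))"
      using p1 by (simp add: pos_le_divide_eq)
    finally show ?thesis .
  qed
qed

text \<open>
  If the graph is not bipartite, cross-multiply the quotient inequality. The difference of the two
  sides then is \<open>(\<theta> 1 - \<theta> d) (a + 1)\<close> times the difference of the two sides of the bound, because
  \<open>b = k - 1 - a\<close>. If the graph is bipartite, then \<open>a = 0\<close> and the bound follows from \<open>\<theta> d \<ge> - k\<close> and \<open>\<theta> 1 \<ge> 0\<close>.
\<close>

lemma fundamental_bound: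
  assumes d: "2 \<le> d"
  defines "k \<equiv> real (valency E)" and "a \<equiv> real (isect_a E 1)" and "b \<equiv> real (isect_b E 1)"
  shows "(\<theta> 1 + k / (a + 1)) * (\<theta> d + k / (a + 1)) \<ge> - (k * a * b) / (a + 1)\<^sup>2"
proof -
  have d0: "0 < d" using d by simp
  have k: "b = k - 1 - a" "a \<ge> 0" "k > 0" using valency_eq[OF d] by (auto simp: k_def a_def b_def)
  have 1: "0 \<le> \<theta> 1" by (rule theta_1_nonneg[OF d])
  have D: "\<theta> d < - 1" "- k \<le> \<theta> d"
    using theta_d_less[OF d] eigenvalue_le_valency(2)[OF d0 eigenvalue_in[of d]] by (auto simp: k_def)
  show ?thesis
  proof (cases "bipartite_graph E")
    case True
    then have "a = 0" using bipartite_graph_iff_isect_a[OF dr] d by (auto simp: a_def)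
    then show ?thesis using 1 D k by simp
  next
    case False
    have Dk: "- k < \<theta> d" using theta_quotient_inequality(2)[OF d False] by (simp add: k_def)
    define s where "s = \<theta> 1"
    define t where "t = \<theta> d"
    have st: "0 \<le> s" "t < - 1" "- k < t" using 1 D Dk by (auto simp: s_def t_def)
    have p1: "(k + s) * (1 + s) > 0" using st k by (intro mult_pos_pos) auto
    have pD: "(k + t) * (1 + t) < 0" using st by (intro mult_pos_neg) auto
    have "(k + t * (a + 1)) / ((k + t) * (1 + t)) \<le> (k + s * (a + 1)) / ((k + s) * (1 + s))"
      using theta_quotient_inequality(1)[OF d False] by (simp add: s_def t_def k_def a_def)
    then have "(k + s * (a + 1)) * ((k + t) * (1 + t)) \<le> (k + t * (a + 1)) * ((k + s) * (1 + s))"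
      using p1 pD by (simp add: neg_divide_le_eq pos_le_divide_eq mult.commute)
    then have "0 \<le> (s - t) * ((a + 1) * (s * t) + k * (s + t) + k * (k - a))"
      by (simp add: algebra_simps)
    then have st0: "0 \<le> (a + 1) * (s * t) + k * (s + t) + k * (k - a)"
      using st by (simp add: zero_le_mult_iff)
    define m where "m = a + 1"
    have m: "m > 0" "m \<noteq> 0" "a = m - 1" using k by (auto simp: m_def)
    have "(s + k / m) * (t + k / m) + k * a * b / m\<^sup>2
      = ((s * m + k) * (t * m + k) + k * a * b) / m\<^sup>2"
      using m(2) by (simp add: field_simps power2_eq_square)
    also have "(s * m + k) * (t * m + k) + k * a * b = m * (m * (s * t) + k * (s + t) + k * (k - a))"
      unfolding k(1) m(3) by (simp add: algebra_simps)
    also have "\<dots> / m\<^sup>2 \<ge> 0" using st0 m(1) by (simp add: m_def)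
    finally show ?thesis unfolding s_def t_def m_def by simp
  qed
qed

end

section \<open>The Fundamental Bound\<close>

theorem theorem6p2:
  fixes E :: "'v::finite \<Rightarrow> 'v \<Rightarrow> bool"
    and d :: nat and k a\<^sub>1 b\<^sub>1 :: real and \<theta> :: "nat \<Rightarrow> real"
  assumes "distance_regular E"
    and "d = graph_diameter E" and "d \<ge> 3"
    and "\<theta> = graph_eigenvalue E"
    and "k = real (valency E)" and "a\<^sub>1 = real (isect_a E 1)" and "b\<^sub>1 = real (isect_b E 1)"
  shows "(\<not> bipartite_graph E \<longrightarrow>
           (k + \<theta> d * (a\<^sub>1 + 1)) / ((k + \<theta> d) * (1 + \<theta> d))
             \<le> (k + \<theta> 1 * (a\<^sub>1 + 1)) / ((k + \<theta> 1) * (1 + \<theta> 1))) \<and>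
         (\<theta> 1 + k / (a\<^sub>1 + 1)) * (\<theta> d + k / (a\<^sub>1 + 1)) \<ge> - (k * a\<^sub>1 * b\<^sub>1) / (a\<^sub>1 + 1)\<^sup>2"
proof -
  interpret G: distance_regular_graph E using assms(1) by unfold_locales
  have "2 \<le> graph_diameter E" using assms(2,3) by simp
  from G.theta_quotient_inequality(1)[OF this] G.fundamental_bound[OF this]
  show ?thesis unfolding assms(2,4-7) by blast
qed

end
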